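(* Let $X$ be a metric space with an isometric proper action of a group $G$, let $\dim X=n$, and let $\mathcal{F}$ be a family of subgroups of $G$. Then any open $\mathcal{F}$-cover $\mathcal{U}$ of $X$ has an open $\mathcal{F}$-refinement $\mathcal{W}$ (that is, an open $\mathcal{F}$-cover $\mathcal{W}$ of $X$ such that every element of $\mathcal{W}$ is contained in an element of $\mathcal{U}$) with dimension at most $n$.
   Context: $\dim X$ is the Lebesgue covering dimension: the smallest integer $n$ such that every open covering of $X$ has an (open) refinement of dimension at most $n$, where the dimension of a family $\mathcal{U}$ of subsets of $X$ is $\sup_{x\in X}|\{U\in\mathcal{U} : x\in U\}|-1$. A family of subgroups of $G$ is a set of subgroups closed under conjugation and under taking subgroups. A subset $U\subseteq X$ is an $\mathcal{F}$-subset if any two elements $gU,g'U$ of its orbit are either equal or disjoint and its stabiliser $\{g\in G : gU=U\}$ belongs to $\mathcal{F}$. An $\mathcal{F}$-cover is a cover consisting of $\mathcal{F}$-subsets which is $G$-invariant as a family (if $U$ belongs to it, so does $gU$ for all $g\in G$). $G$ is discrete; the action is proper if every $x\in X$ has a neighbourhood $U$ such that $\{g\in G : gU\cap U\ne\emptyset\}$ is finite. *)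

theory Defs
  imports "HOL-Analysis.Analysis" "HOL-Algebra.Group_Action"
begin

definition ecard :: "'a set \<Rightarrow> enat" where
  "ecard A = (if finite A then enat (card A) else \<infinity>)"

text \<open>
  The supremum is taken in \<^typ>\<open>enat\<close>, so it is \<open>0\<close> over an empty \<open>X\<close>: every family of
  subsets of the empty space has dimension \<open>-1\<close>. In general the value is \<open>\<ge> -1\<close> and may be \<open>\<infinity>\<close>.
\<close>
definition family_dim :: "'a set \<Rightarrow> 'a set set \<Rightarrow> ereal" where
  "family_dim X \<U> = ereal_of_enat (SUP x\<in>X. ecard {U \<in> \<U>. x \<in> U}) - 1"

definition open_cover :: "'a topology \<Rightarrow> 'a set set \<Rightarrow> bool" where
  "open_cover X \<U> \<longleftrightarrow> (\<forall>U\<in>\<U>. openin X U) \<and> \<Union>\<U> = topspace X"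

definition refines_cover :: "'a set set \<Rightarrow> 'a set set \<Rightarrow> bool" where
  "refines_cover \<V> \<U> \<longleftrightarrow> (\<forall>V\<in>\<V>. \<exists>U\<in>\<U>. V \<subseteq> U)"

definition covering_dim_le :: "'a topology \<Rightarrow> int \<Rightarrow> bool" where
  "covering_dim_le X n \<longleftrightarrow>
     (\<forall>\<U>. open_cover X \<U> \<longrightarrow>
        (\<exists>\<V>. open_cover X \<V> \<and> refines_cover \<V> \<U> \<and> family_dim (topspace X) \<V> \<le> ereal (of_int n)))"

text \<open>
  Lebesgue covering dimension; it differs in general from the small inductive dimension bounded by
  \<^const>\<open>dimension_le\<close>. The least integer exists whenever there is any, because
  \<^const>\<open>covering_dim_le\<close> fails below \<open>-1\<close>. The empty space has dimension \<open>-1\<close>.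
\<close>
definition covering_dim :: "'a topology \<Rightarrow> ereal" where
  "covering_dim X =
     (if \<exists>n. covering_dim_le X n then ereal (of_int (LEAST n. covering_dim_le X n)) else \<infinity>)"

lemma covering_dim_le_lower_bound:
  assumes "covering_dim_le X n"
  shows "-1 \<le> n"
proof -
  have "open_cover X {topspace X}"
    by (simp add: open_cover_def)
  then obtain \<V> where "family_dim (topspace X) \<V> \<le> ereal (of_int n)"
    using assms unfolding covering_dim_le_def by blast
  moreover have "-1 \<le> family_dim (topspace X) \<V>"
    unfolding family_dim_def
    by (cases "SUP x\<in>topspace X. ecard {U \<in> \<V>. x \<in> U}")
       (simp_all add: one_ereal_def)
  ultimately have "(-1::ereal) \<le> ereal (of_int n)"
    by (rule order_trans[rotated])
  then show ?thesis
    by (simp add: one_ereal_def)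
qed

lemma covering_dim_eq_iff:
  "covering_dim X = ereal (of_int n) \<longleftrightarrow>
     covering_dim_le X n \<and> (\<forall>m. covering_dim_le X m \<longrightarrow> n \<le> m)"
proof (cases "\<exists>k. covering_dim_le X k")
  case True
  then obtain k where k: "covering_dim_le X k" by blast
  obtain l where l: "covering_dim_le X l"
    and min: "\<And>m. covering_dim_le X m \<Longrightarrow> nat (l + 1) \<le> nat (m + 1)"
    using ex_has_least_nat[of "covering_dim_le X" k "\<lambda>m. nat (m + 1)"] k by blast
  have least: "l \<le> m" if "covering_dim_le X m" for m
    using min[OF that] covering_dim_le_lower_bound[OF that] covering_dim_le_lower_bound[OF l]
    by linarith
  have "(LEAST m. covering_dim_le X m) = l"
    by (rule Least_equality) (use l least in auto)
  then show ?thesis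
    using True l least by (auto simp: covering_dim_def intro: antisym)
qed (auto simp: covering_dim_def)

definition subgroup_family :: "('g, 'c) monoid_scheme \<Rightarrow> 'g set set \<Rightarrow> bool" where
  "subgroup_family G \<F> \<longleftrightarrow>
     (\<forall>H\<in>\<F>. subgroup H G) \<and>
     (\<forall>H\<in>\<F>. \<forall>g\<in>carrier G. g <#\<^bsub>G\<^esub> H #>\<^bsub>G\<^esub> inv\<^bsub>G\<^esub> g \<in> \<F>) \<and>
     (\<forall>H\<in>\<F>. \<forall>K. subgroup K G \<and> K \<subseteq> H \<longrightarrow> K \<in> \<F>)"

definition isometric_action ::
  "('g, 'c) monoid_scheme \<Rightarrow> 'a set \<Rightarrow> ('a \<Rightarrow> 'a \<Rightarrow> real) \<Rightarrow> ('g \<Rightarrow> 'a \<Rightarrow> 'a) \<Rightarrow> bool" where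
  "isometric_action G M d \<phi> \<longleftrightarrow>
     group_action G M \<phi> \<and>
     (\<forall>g\<in>carrier G. \<forall>x\<in>M. \<forall>y\<in>M. d (\<phi> g x) (\<phi> g y) = d x y)"

text \<open>Here \<open>G\<close> is a discrete group and \<open>\<phi>\<close> is an action on \<^term>\<open>topspace X\<close>.\<close>
definition proper_action ::
  "('g, 'c) monoid_scheme \<Rightarrow> 'a topology \<Rightarrow> ('g \<Rightarrow> 'a \<Rightarrow> 'a) \<Rightarrow> bool" where
  "proper_action G X \<phi> \<longleftrightarrow>
     (\<forall>x\<in>topspace X. \<exists>U. openin X U \<and> x \<in> U \<and> finite {g \<in> carrier G. \<phi> g ` U \<inter> U \<noteq> {}})"

definition F_subset ::
  "('g, 'c) monoid_scheme \<Rightarrow> 'a set \<Rightarrow> ('g \<Rightarrow> 'a \<Rightarrow> 'a) \<Rightarrow> 'g set set \<Rightarrow> 'a set \<Rightarrow> bool" where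
  "F_subset G X \<phi> \<F> U \<longleftrightarrow>
     U \<subseteq> X \<and>
     (\<forall>g\<in>carrier G. \<forall>g'\<in>carrier G. \<phi> g ` U = \<phi> g' ` U \<or> \<phi> g ` U \<inter> \<phi> g' ` U = {}) \<and>
     {g \<in> carrier G. \<phi> g ` U = U} \<in> \<F>"

definition F_cover ::
  "('g, 'c) monoid_scheme \<Rightarrow> 'a set \<Rightarrow> ('g \<Rightarrow> 'a \<Rightarrow> 'a) \<Rightarrow> 'g set set \<Rightarrow> 'a set set \<Rightarrow> bool" where
  "F_cover G X \<phi> \<F> \<U> \<longleftrightarrow>
     \<Union>\<U> = X \<and>
     (\<forall>U\<in>\<U>. F_subset G X \<phi> \<F> U) \<and>
     (\<forall>U\<in>\<U>. \<forall>g\<in>carrier G. \<phi> g ` U \<in> \<U>)"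

definition open_F_cover ::
  "('g, 'c) monoid_scheme \<Rightarrow> 'a topology \<Rightarrow> ('g \<Rightarrow> 'a \<Rightarrow> 'a) \<Rightarrow> 'g set set \<Rightarrow> 'a set set \<Rightarrow> bool" where
  "open_F_cover G X \<phi> \<F> \<U> \<longleftrightarrow> F_cover G (topspace X) \<phi> \<F> \<U> \<and> (\<forall>U\<in>\<U>. openin X U)"

end

theory Submission
  imports Defs
begin

text \<open>
  The theorem amounts to the estimate \<open>dim (M/G) \<le> dim M\<close>. Indeed, suppose that every cover of \<open>M\<close>
  by invariant open sets has an invariant open refinement of order at most \<open>n + 1\<close>. Apply this to
  the saturations of the members \<open>U\<close> of the given cover, with result \<open>V\<^sub>U\<close>, and cut the sets back to
  \<open>V\<^sub>U \<inter> gU\<close>. Since the translates of \<open>U\<close> are equal or disjoint, a point lies in only one of these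
  sets for each \<open>V\<^sub>U\<close> that contains it, so the order does not grow; and such a set, when it is
  nonempty, has the same stabiliser as \<open>gU\<close> (\<open>open_F_refinement\<close>).

  The estimate is proved without forming the quotient (\<open>invariant_covering_dim\<close>). For \<open>\<eta> > 0\<close> let
  \<open>orbit_gap \<eta>\<close> be the set of points that every group element either fixes or moves by at least \<open>\<eta>\<close>.
  It is closed, because displacements vary continuously, and by properness every point belongs to
  one of these sets. Two points of \<open>orbit_gap \<eta>\<close> in the same orbit are equal as soon as they are
  less than \<open>\<eta>\<close> apart, so there the quotient map is injective on sets of diameter less than \<open>\<eta>\<close>.
  Stone's device of well-ordering a cover by small sets divides \<open>orbit_gap \<eta>\<close> into countably many
  closed invariant pieces, each of which has a closed slice that meets every orbit of the piece
  in exactly one point (\<open>discrete_pieces\<close>, \<open>thinnable_pieces\<close>). On the slice, which is closed in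
  \<open>M\<close>, covers can be thinned because \<open>dim M \<le> n\<close>, and saturating the result thins an invariant
  cover on the whole piece (\<open>thinnable_of_slice\<close>).

  The pieces are put together by an invariant form of the countable closed sum theorem of
  dimension theory (\<open>countable_sum\<close>). Its ingredients, a shrinking and a swelling of families of
  sets, are given by formulas in the metric; isometries therefore preserve them, and invariance is
  inherited at each stage.
\<close>

section \<open>Order of a cover\<close>

definition at_most :: "nat \<Rightarrow> 'b set \<Rightarrow> bool" where
  "at_most N T \<longleftrightarrow> finite T \<and> card T \<le> N"

lemma at_most_mono: "at_most N T \<Longrightarrow> T' \<subseteq> T \<Longrightarrow> at_most N T'"
  unfolding at_most_def by (meson card_mono finite_subset le_trans)

lemma at_most_image: "at_most N T \<Longrightarrow> at_most N (f ` T)"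
  unfolding at_most_def by (meson card_image_le finite_imageI le_trans)

lemma at_most_if_finite_subsets:
  assumes "\<And>T'. T' \<subseteq> T \<Longrightarrow> finite T' \<Longrightarrow> card T' \<le> N"
  shows "at_most N T"
  unfolding at_most_def using finite_if_finite_subsets_card_bdd[of T N] assms by blast

lemma family_dim_le_iff:
  assumes "-1 \<le> n"
  shows "family_dim X \<V> \<le> ereal (of_int n) \<longleftrightarrow> (\<forall>x\<in>X. at_most (nat (n + 1)) {V\<in>\<V>. x \<in> V})"
proof -
  define k where "k = (SUP x\<in>X. ecard {V\<in>\<V>. x \<in> V})"
  have "ereal_of_enat k - 1 \<le> ereal (of_int n) \<longleftrightarrow> k \<le> enat (nat (n + 1))"
  proof (cases k)
    case (enat m)
    have "real m - 1 \<le> of_int n \<longleftrightarrow> m \<le> nat (n + 1)"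
      using assms by linarith
    then show ?thesis
      by (simp add: enat one_ereal_def)
  qed simp
  then have "family_dim X \<V> \<le> ereal (of_int n) \<longleftrightarrow> k \<le> enat (nat (n + 1))"
    by (simp add: family_dim_def k_def)
  also have "\<dots> \<longleftrightarrow> (\<forall>x\<in>X. ecard {V\<in>\<V>. x \<in> V} \<le> enat (nat (n + 1)))"
    unfolding k_def by (simp add: SUP_le_iff)
  also have "\<dots> \<longleftrightarrow> (\<forall>x\<in>X. at_most (nat (n + 1)) {V\<in>\<V>. x \<in> V})"
    by (auto simp: ecard_def at_most_def split: if_splits)
  finally show ?thesis .
qed

section \<open>Metric spaces\<close>

context Metric_space
begin

lemma closedin_metric_limit:
  assumes "C \<subseteq> M"
    and "\<And>x. x \<in> M \<Longrightarrow> (\<And>e. 0 < e \<Longrightarrow> \<exists>y\<in>C. d x y < e) \<Longrightarrow> x \<in> C"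
  shows "closedin mtopology C"
proof -
  have "\<exists>r>0. disjnt C (mball x r)" if "x \<in> M - C" for x
  proof -
    have "\<not> (\<forall>e>0. \<exists>y\<in>C. d x y < e)"
      using assms(2)[of x] that by blast
    then obtain e where "0 < e" "\<And>y. y \<in> C \<Longrightarrow> \<not> d x y < e"
      by blast
    then show ?thesis
      by (intro exI[of _ e]) (auto simp: disjnt_iff)
  qed
  then show ?thesis
    using assms(1) by (simp add: closedin_metric)
qed

text \<open>
  The distance to the complement, capped at 1 so that it is finite for \<open>U = M\<close> and suprema over
  families exist.
\<close>
definition depth :: "'a set \<Rightarrow> 'a \<Rightarrow> real" where
  "depth U x = Inf (insert 1 (d x ` (M - U)))"

lemma depth_bdd: "bdd_below (insert 1 (d x ` Z))"
  by (intro bdd_belowI[of _ 0]) auto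

lemma depth_le_1: "depth U x \<le> 1"
  unfolding depth_def by (intro cInf_lower depth_bdd) auto

lemma depth_le: "z \<in> M - U \<Longrightarrow> depth U x \<le> d x z"
  unfolding depth_def by (intro cInf_lower depth_bdd) auto

lemma depth_ge: "e \<le> 1 \<Longrightarrow> (\<And>z. z \<in> M - U \<Longrightarrow> e \<le> d x z) \<Longrightarrow> e \<le> depth U x"
  unfolding depth_def by (intro cInf_greatest) auto

lemma depth_Lipschitz:
  assumes "x \<in> M" "y \<in> M"
  shows "depth U y \<le> depth U x + d x y"
proof -
  have "depth U y - d x y \<le> depth U x"
  proof (rule depth_ge)
    show "depth U y - d x y \<le> 1"
      using depth_le_1[of U y] nonneg[of x y] by linarith
  next
    fix z assume z: "z \<in> M - U"
    then have "d y z \<le> d x y + d x z"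
      using triangle[of y x z] assms by (auto simp: commute)
    then show "depth U y - d x y \<le> d x z"
      using depth_le[OF z, of y] by linarith
  qed
  then show ?thesis by linarith
qed

lemma depth_pos_imp: "x \<in> M \<Longrightarrow> 0 < depth U x \<Longrightarrow> x \<in> U"
  using depth_le[of x U x] by fastforce

lemma depth_pos:
  assumes "openin mtopology U" "x \<in> U"
  shows "0 < depth U x"
proof -
  obtain r where r: "0 < r" "mball x r \<subseteq> U"
    using assms unfolding openin_mtopology by blast
  have "x \<in> M"
    using assms openin_subset by fastforce
  have "min 1 r \<le> depth U x"
    using r \<open>x \<in> M\<close> by (intro depth_ge) (fastforce simp: mball_def)+
  then show ?thesis
    using r by linarith
qed

text \<open>
  Comparing each depth with half of the supremum of all depths gives an open shrinking of an
  arbitrary open cover, point-finite or not.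
\<close>
definition shrink :: "'s set \<Rightarrow> ('s \<Rightarrow> 'a set) \<Rightarrow> 's \<Rightarrow> 'a set" where
  "shrink S U s = {x\<in>M. (SUP t\<in>S. depth (U t) x) / 2 < depth (U s) x}"

text \<open>
  The supremum \<open>g\<close> of the depths is positive and, like the depths themselves, Lipschitz. Hence the
  first two claims; for the third, a point of \<open>shrink S U s\<close> within \<open>g x / 4\<close> of \<open>x\<close> has depth in
  \<open>U s\<close> more than \<open>3/8\<close> of \<open>g x\<close>, which leaves \<open>x\<close> positive depth. The third claim is stronger
  than that closures of the shrunken sets lie in the original ones: the radius does not depend
  on \<open>s\<close>, so a family that is merely finite at \<open>x\<close> becomes locally finite there. This takes the
  place of paracompactness in the sum theorem.
\<close>
lemma shrink_properties:
  assumes op: "\<And>s. s \<in> S \<Longrightarrow> openin mtopology (U s)"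
    and cov: "(\<Union>s\<in>S. U s) = M"
  shows "\<And>s. s \<in> S \<Longrightarrow> openin mtopology (shrink S U s)"
    and "(\<Union>s\<in>S. shrink S U s) = M"
    and "\<And>x. x \<in> M \<Longrightarrow> \<exists>e>0. \<forall>s\<in>S. shrink S U s \<inter> mball x e \<noteq> {} \<longrightarrow> x \<in> U s"
proof -
  define g where "g x = (SUP t\<in>S. depth (U t) x)" for x
  have bdd: "bdd_above ((\<lambda>t. depth (U t) x) ` S)" for x
    by (intro bdd_aboveI[of _ 1]) (auto simp: depth_le_1)
  have g_upper: "depth (U s) x \<le> g x" if "s \<in> S" for s x
    unfolding g_def using that bdd by (intro cSUP_upper)
  have g_pos: "0 < g x" if x: "x \<in> M" for x
  proof -
    obtain s where s: "s \<in> S" "x \<in> U s"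
      using x cov by blast
    then show ?thesis
      using depth_pos[OF op] g_upper[of s x] by fastforce
  qed
  have g_Lip: "g y \<le> g x + d x y" if "x \<in> M" "y \<in> M" for x y
  proof -
    have "S \<noteq> {}"
      using that cov by blast
    then have "(SUP t\<in>S. depth (U t) y) \<le> g x + d x y"
    proof (rule cSUP_least)
      fix s assume "s \<in> S"
      then show "depth (U s) y \<le> g x + d x y"
        using depth_Lipschitz[OF that, of "U s"] g_upper[of s x] by linarith
    qed
    then show ?thesis
      by (simp add: g_def)
  qed
  have W: "shrink S U s = {x\<in>M. g x / 2 < depth (U s) x}" for s
    by (simp add: shrink_def g_def)
  show "openin mtopology (shrink S U s)" for s
    unfolding openin_mtopology
  proof (intro conjI allI impI)
    fix x assume "x \<in> shrink S U s"
    then have x: "x \<in> M" "g x / 2 < depth (U s) x"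
      by (auto simp: W)
    define e where "e = (depth (U s) x - g x / 2) / 2"
    have "mball x e \<subseteq> shrink S U s"
    proof
      fix y assume "y \<in> mball x e"
      then have y: "y \<in> M" "d x y < e"
        by auto
      then have "g y \<le> g x + e" "depth (U s) x - e < depth (U s) y"
        using g_Lip[of x y] depth_Lipschitz[of y x "U s"] x by (auto simp: commute)
      then show "y \<in> shrink S U s"
        using y x by (auto simp: W e_def field_simps)
    qed
    moreover have "0 < e"
      using x by (simp add: e_def)
    ultimately show "\<exists>r>0. mball x r \<subseteq> shrink S U s"
      by blast
  qed (auto simp: shrink_def)
  show "(\<Union>s\<in>S. shrink S U s) = M"
  proof
    show "M \<subseteq> (\<Union>s\<in>S. shrink S U s)"
    proof
      fix x assume x: "x \<in> M"
      have "S \<noteq> {}"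
        using x cov by blast
      have "g x / 2 < g x"
        using g_pos[OF x] by simp
      then obtain s where "s \<in> S" "g x / 2 < depth (U s) x"
        unfolding g_def less_cSUP_iff[OF \<open>S \<noteq> {}\<close> bdd] by blast
      then show "x \<in> (\<Union>s\<in>S. shrink S U s)"
        using x by (auto simp: W)
    qed
  qed (auto simp: shrink_def)
  show "\<exists>e>0. \<forall>s\<in>S. shrink S U s \<inter> mball x e \<noteq> {} \<longrightarrow> x \<in> U s" if x: "x \<in> M" for x
  proof (intro exI[of _ "g x / 4"] conjI ballI impI)
    fix s assume s: "s \<in> S" and "shrink S U s \<inter> mball x (g x / 4) \<noteq> {}"
    then obtain y where y: "y \<in> M" "g y / 2 < depth (U s) y" "d x y < g x / 4"
      by (auto simp: W)
    then have "0 < depth (U s) x"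
      using g_Lip[OF y(1) x] depth_Lipschitz[OF x y(1), of "U s"] commute[of x y]
        nonneg[of x y] by linarith
    then show "x \<in> U s"
      by (rule depth_pos_imp[OF x])
  qed (use g_pos[OF x] in auto)
qed

text \<open>
  The choice depends only on which sets of the family contain \<open>x\<close> and which balls around \<open>x\<close> they
  meet. Both are the same for a translate of \<open>x\<close> if the family is invariant, so the radius is
  constant on orbits.
\<close>
definition isolating_radius :: "'s set \<Rightarrow> ('s \<Rightarrow> 'a set) \<Rightarrow> 'a \<Rightarrow> real" where
  "isolating_radius S F x = (SOME e. 0 < e \<and> (\<forall>s\<in>S. F s \<inter> mball x e \<noteq> {} \<longrightarrow> x \<in> F s))"

definition swell :: "'s set \<Rightarrow> ('s \<Rightarrow> 'a set) \<Rightarrow> 's \<Rightarrow> 'a set" where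
  "swell S F s = (\<Union>x\<in>F s. mball x (isolating_radius S F x / 2))"

text \<open>
  A locally finite closed family enlarges to an open family of the same order: if the swellings
  of several members share a point, then one of the centres involved lies in all of these members.
\<close>
lemma swell_properties:
  assumes sub: "\<And>s. s \<in> S \<Longrightarrow> F s \<subseteq> M"
    and near: "\<And>x. x \<in> M \<Longrightarrow> \<exists>e>0. \<forall>s\<in>S. F s \<inter> mball x e \<noteq> {} \<longrightarrow> x \<in> F s"
    and ord: "\<And>x. x \<in> M \<Longrightarrow> at_most N {s\<in>S. x \<in> F s}"
  shows "\<And>s. openin mtopology (swell S F s)"
    and "\<And>s. s \<in> S \<Longrightarrow> F s \<subseteq> swell S F s"
    and "\<And>y. y \<in> M \<Longrightarrow> at_most N {s\<in>S. y \<in> swell S F s}"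
proof -
  let ?r = "isolating_radius S F"
  have r: "0 < ?r x" "\<And>s. s \<in> S \<Longrightarrow> F s \<inter> mball x (?r x) \<noteq> {} \<Longrightarrow> x \<in> F s" if "x \<in> M" for x
    using someI_ex[OF near[OF that]] unfolding isolating_radius_def by blast+
  show "openin mtopology (swell S F s)" for s
    unfolding swell_def by blast
  show "F s \<subseteq> swell S F s" if "s \<in> S" for s
    using sub[OF that] r(1) unfolding swell_def by fastforce
  show "at_most N {s\<in>S. y \<in> swell S F s}" if y: "y \<in> M" for y
  proof (rule at_most_if_finite_subsets)
    fix T assume T: "T \<subseteq> {s\<in>S. y \<in> swell S F s}" "finite T"
    show "card T \<le> N"
    proof (cases "T = {}")
      case False
      have "\<forall>s\<in>T. \<exists>x\<in>F s. d x y < ?r x / 2"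
        using T unfolding swell_def by fastforce
      then obtain p where p: "\<And>s. s \<in> T \<Longrightarrow> p s \<in> F s \<and> d (p s) y < ?r (p s) / 2"
        by metis
      have pM: "p s \<in> M" if "s \<in> T" for s
        using p[OF that] T sub that by blast
      \<comment> \<open>Whichever of the balls around \<open>y\<close> is largest, doubling it reaches all other centres.\<close>
      obtain t where t: "t \<in> T" "\<And>s. s \<in> T \<Longrightarrow> ?r (p s) \<le> ?r (p t)"
      proof -
        have "Max ((\<lambda>s. ?r (p s)) ` T) \<in> (\<lambda>s. ?r (p s)) ` T"
          using T(2) False by (intro Max_in) auto
        then obtain t where "t \<in> T" "?r (p t) = Max ((\<lambda>s. ?r (p s)) ` T)"
          by auto
        then show thesis
          using that T(2) by simp
      qed
      have "p t \<in> F s" if s: "s \<in> T" for s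
      proof (rule r(2))
        have "d (p t) (p s) \<le> d (p t) y + d (p s) y"
          using triangle[of "p t" y "p s"] pM s t y by (auto simp: commute)
        also have "\<dots> < ?r (p t)"
          using p[OF s] p[OF t(1)] t(2)[OF s] by linarith
        finally have "p s \<in> F s \<inter> mball (p t) (?r (p t))"
          using p[OF s] pM[OF s] pM[OF t(1)] by auto
        then show "F s \<inter> mball (p t) (?r (p t)) \<noteq> {}"
          by blast
      qed (use T s pM t in auto)
      then have "T \<subseteq> {s\<in>S. p t \<in> F s}"
        using T by blast
      then show ?thesis
        using at_most_mono[OF ord[OF pM[OF t(1)]]] unfolding at_most_def by blast
    qed simp
  qed
qed

text \<open>
  Stone's construction: well-order the index set and let \<open>c x\<close> be the first index whose set
  contains \<open>x\<close>. If \<open>c x\<close> comes before \<open>c y\<close>, then \<open>y \<notin> Q (c x)\<close>, so if the \<open>r\<close>-ball around \<open>x\<close> lies in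
  \<open>Q (c x)\<close>, then \<open>y\<close> is at distance at least \<open>r\<close> from \<open>x\<close>. On the set of all such \<open>x\<close> the map \<open>c\<close> is
  thus locally constant at scale \<open>r\<close>. The set is closed, because at a limit point \<open>c\<close> cannot drop:
  the earlier \<open>Q\<close>'s are open and would catch nearby points too. Taking \<open>r = 1, 1/2, 1/3, ...\<close> these sets
  exhaust \<open>M\<close>. The second property makes \<open>c\<close> invariant when the \<open>Q\<close>'s are.
\<close>
lemma discrete_pieces:
  fixes Q :: "'i \<Rightarrow> 'a set"
  assumes op: "\<And>i. i \<in> I \<Longrightarrow> openin mtopology (Q i)"
    and cov: "(\<Union>i\<in>I. Q i) = M"
  obtains c where "\<And>x. x \<in> M \<Longrightarrow> c x \<in> I \<and> x \<in> Q (c x)"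
    and "\<And>x y. (\<forall>i\<in>I. x \<in> Q i \<longleftrightarrow> y \<in> Q i) \<Longrightarrow> c x = c y"
    and "\<And>r. 0 < r \<Longrightarrow> closedin mtopology {x\<in>M. mball x r \<subseteq> Q (c x)}"
    and "\<And>x y r. x \<in> M \<Longrightarrow> y \<in> M \<Longrightarrow> mball x r \<subseteq> Q (c x) \<Longrightarrow> mball y r \<subseteq> Q (c y) \<Longrightarrow>
           d x y < r \<Longrightarrow> c x = c y"
proof -
  obtain R :: "'i rel" where R: "well_order_on UNIV R"
    using well_order_on by blast
  then have wf: "wf (R - Id)" and lin: "linear_order_on UNIV R"
    by (auto simp: well_order_on_def)
  have tot: "(i, j) \<in> R \<or> (j, i) \<in> R" for i j
    using lin by (cases "i = j")
      (auto simp: linear_order_on_def partial_order_on_def preorder_on_def refl_on_def total_on_def)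
  have anti: "i = j" if "(i, j) \<in> R" "(j, i) \<in> R" for i j
    using lin that by (auto simp: linear_order_on_def partial_order_on_def antisym_def)
  define c where "c x = (SOME i. i \<in> I \<and> x \<in> Q i \<and> (\<forall>j\<in>I. x \<in> Q j \<longrightarrow> (i, j) \<in> R))" for x
  have c: "c x \<in> I \<and> x \<in> Q (c x) \<and> (\<forall>j\<in>I. x \<in> Q j \<longrightarrow> (c x, j) \<in> R)" if "x \<in> M" for x
  proof -
    have "{i\<in>I. x \<in> Q i} \<noteq> {}"
      using that cov by blast
    then obtain i where i: "i \<in> {i\<in>I. x \<in> Q i}"
      "\<And>j. (j, i) \<in> R - Id \<Longrightarrow> j \<notin> {i\<in>I. x \<in> Q i}"
      by (rule wfE_min'[OF wf]) blast
    then have "i \<in> I \<and> x \<in> Q i \<and> (\<forall>j\<in>I. x \<in> Q j \<longrightarrow> (i, j) \<in> R)"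
      using tot by blast
    then show ?thesis
      unfolding c_def by (rule someI)
  qed
  have sep: "c x = c y"
    if xy: "x \<in> M" "y \<in> M" "mball x r \<subseteq> Q (c x)" "mball y r \<subseteq> Q (c y)" "d x y < r" for x y r
  proof -
    have "y \<in> Q (c x)" "x \<in> Q (c y)"
      using xy by (auto simp: commute subset_iff)
    then show ?thesis
      using c[OF xy(1)] c[OF xy(2)] anti by blast
  qed
  show ?thesis
  proof (rule that[of c])
    show "c x \<in> I \<and> x \<in> Q (c x)" if "x \<in> M" for x
      using c[OF that] by blast
    show "c x = c y" if "\<forall>i\<in>I. x \<in> Q i \<longleftrightarrow> y \<in> Q i" for x y
      unfolding c_def by (rule arg_cong[where f = Eps]) (use that in blast)
    fix r :: real assume r: "0 < r"
    let ?C = "{x\<in>M. mball x r \<subseteq> Q (c x)}"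
    show "closedin mtopology ?C"
    proof (rule closedin_metric_limit)
      fix x assume x: "x \<in> M" and lim: "\<And>e. 0 < e \<Longrightarrow> \<exists>y\<in>?C. d x y < e"
      obtain y0 where y0: "y0 \<in> ?C" "d x y0 < r / 2"
        using lim[of "r / 2"] r by auto
      have const: "c y = c y0" if "y \<in> ?C" "d x y < r / 2" for y
      proof (rule sep)
        show "d y y0 < r"
          using triangle[of y x y0] that y0 x by (auto simp: commute)
      qed (use that y0 in auto)
      have "x \<in> mball y0 r"
        using x y0 r by (auto simp: commute)
      then have "x \<in> Q (c y0)"
        using y0 by auto
      have "c x = c y0"
      proof -
        have "openin mtopology (Q (c x))" "x \<in> Q (c x)"
          using c[OF x] op by auto
        then obtain e where e: "0 < e" "mball x e \<subseteq> Q (c x)"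
          unfolding openin_mtopology by blast
        obtain y where y: "y \<in> ?C" "d x y < min e (r / 2)"
          using lim[of "min e (r / 2)"] e r by auto
        then have "y \<in> Q (c x)"
          using e x by auto
        then have "(c y0, c x) \<in> R"
          using c[of y] c[OF x] const[of y] y by auto
        moreover have "(c x, c y0) \<in> R"
          using c[OF x] c[of y0] y0 \<open>x \<in> Q (c y0)\<close> by auto
        ultimately show ?thesis
          using anti by blast
      qed
      moreover have "mball x r \<subseteq> Q (c y0)"
      proof
        fix z assume "z \<in> mball x r"
        then have z: "z \<in> M" "d x z < r"
          by auto
        obtain y where y: "y \<in> ?C" "d x y < min (r - d x z) (r / 2)"
          using lim[of "min (r - d x z) (r / 2)"] z r by auto
        then have "d y z < r"
          using triangle[of y x z] x z by (auto simp: commute)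
        then show "z \<in> Q (c y0)"
          using y z const[of y] by auto
      qed
      ultimately show "x \<in> ?C"
        using x by simp
    qed auto
  qed (use sep in blast)
qed

text \<open>
  Adding the complement of \<open>B\<close> gives an open cover of \<open>M\<close>. In a refinement of it, the members that
  meet \<open>B\<close> are merged according to a set \<open>U s\<close> that contains them; merging does not raise the order.
\<close>
lemma closed_subset_thin:
  assumes dim: "covering_dim_le mtopology n"
    and B: "closedin mtopology B"
    and op: "\<And>s. s \<in> S \<Longrightarrow> openin mtopology (U s)"
    and cov: "B \<subseteq> (\<Union>s\<in>S. U s)"
  obtains V where "\<And>s. s \<in> S \<Longrightarrow> openin mtopology (V s)" "\<And>s. s \<in> S \<Longrightarrow> V s \<subseteq> U s"
    "B \<subseteq> (\<Union>s\<in>S. V s)" "\<And>x. x \<in> M \<Longrightarrow> at_most (nat (n + 1)) {s\<in>S. x \<in> V s}"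
proof -
  have "open_cover mtopology (insert (M - B) (U ` S))"
    unfolding open_cover_def using op B cov openin_subset[OF op]
    by (auto simp: closedin_def subset_iff)
  then obtain \<V> where \<V>: "open_cover mtopology \<V>" "refines_cover \<V> (insert (M - B) (U ` S))"
    "family_dim M \<V> \<le> ereal (of_int n)"
    using dim unfolding covering_dim_le_def by (metis topspace_mtopology)
  have "\<forall>V\<in>\<V>. V \<inter> B \<noteq> {} \<longrightarrow> (\<exists>s\<in>S. V \<subseteq> U s)"
    using \<V>(2) unfolding refines_cover_def by blast
  then obtain f where f: "\<And>V. V \<in> \<V> \<Longrightarrow> V \<inter> B \<noteq> {} \<Longrightarrow> f V \<in> S \<and> V \<subseteq> U (f V)"
    by metis
  define V where "V s = \<Union>{W\<in>\<V>. W \<inter> B \<noteq> {} \<and> f W = s}" for s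
  show ?thesis
  proof (rule that[of V])
    show "openin mtopology (V s)" for s
      using \<V>(1) unfolding V_def open_cover_def by auto
    show "V s \<subseteq> U s" for s
      using f unfolding V_def by auto
    show "B \<subseteq> (\<Union>s\<in>S. V s)"
    proof
      fix x assume x: "x \<in> B"
      then have "x \<in> M"
        using closedin_subset[OF B] by auto
      then obtain W where "W \<in> \<V>" "x \<in> W"
        using \<V>(1) unfolding open_cover_def by auto
      then show "x \<in> (\<Union>s\<in>S. V s)"
        using f[of W] x unfolding V_def by blast
    qed
    fix x assume x: "x \<in> M"
    have "at_most (nat (n + 1)) {W\<in>\<V>. x \<in> W}"
      using \<V>(3) x family_dim_le_iff[OF covering_dim_le_lower_bound[OF dim]] by blast
    then have "at_most (nat (n + 1)) (f ` {W\<in>\<V>. x \<in> W})"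
      by (rule at_most_image)
    then show "at_most (nat (n + 1)) {s\<in>S. x \<in> V s}"
      by (rule at_most_mono) (auto simp: V_def)
  qed
qed

end

section \<open>Invariant covers\<close>

locale isometric_group_action =
  Metric_space M d + group_action G M \<phi>
  for G :: "('g, 'c) monoid_scheme" (structure) and M :: "'a set" and d and \<phi> +
  assumes isometry: "g \<in> carrier G \<Longrightarrow> x \<in> M \<Longrightarrow> y \<in> M \<Longrightarrow> d (\<phi> g x) (\<phi> g y) = d x y"
begin

lemma act_closed: "g \<in> carrier G \<Longrightarrow> x \<in> M \<Longrightarrow> \<phi> g x \<in> M"
  by (rule element_image[of g x "\<phi> g x"]) auto

lemma act_one: "x \<in> M \<Longrightarrow> \<phi> \<one> x = x"
  using id_eq_one by (metis restrict_apply')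

lemma act_mult:
  "g \<in> carrier G \<Longrightarrow> h \<in> carrier G \<Longrightarrow> x \<in> M \<Longrightarrow> \<phi> (g \<otimes> h) x = \<phi> g (\<phi> h x)"
  using composition_rule by blast

lemma act_inv: "g \<in> carrier G \<Longrightarrow> x \<in> M \<Longrightarrow> \<phi> (inv g) (\<phi> g x) = x"
  using orbit_sym_aux by blast

lemma group_G: "group G"
  using group_hom group_hom.axioms(1) by blast

lemma inv_in: "g \<in> carrier G \<Longrightarrow> inv g \<in> carrier G"
  using group.inv_closed[OF group_G] .

lemma act_inv': "g \<in> carrier G \<Longrightarrow> x \<in> M \<Longrightarrow> \<phi> g (\<phi> (inv g) x) = x"
  using act_inv[of "inv g" x] inv_in group.inv_inv[OF group_G] by simp

definition invariant :: "'a set \<Rightarrow> bool" where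
  "invariant A \<longleftrightarrow> A \<subseteq> M \<and> (\<forall>g\<in>carrier G. \<forall>x\<in>A. \<phi> g x \<in> A)"

lemma invariant_iff:
  assumes "invariant A" "g \<in> carrier G" "x \<in> M"
  shows "\<phi> g x \<in> A \<longleftrightarrow> x \<in> A"
  using assms act_inv inv_in unfolding invariant_def by metis

definition invariant_open_cover :: "'s set \<Rightarrow> ('s \<Rightarrow> 'a set) \<Rightarrow> bool" where
  "invariant_open_cover S U \<longleftrightarrow>
     (\<forall>s\<in>S. openin mtopology (U s) \<and> invariant (U s)) \<and> (\<Union>s\<in>S. U s) = M"

lemma depth_invariant:
  assumes "invariant U" "g \<in> carrier G" "x \<in> M"
  shows "depth U (\<phi> g x) = depth U x"
proof -
  have "d (\<phi> g x) ` (M - U) = d x ` (M - U)"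
  proof (intro subset_antisym subsetI)
    fix t assume "t \<in> d (\<phi> g x) ` (M - U)"
    then obtain z where z: "z \<in> M" "z \<notin> U" "t = d (\<phi> g x) z"
      by blast
    then have "t = d x (\<phi> (inv g) z)"
      using isometry[of g x "\<phi> (inv g) z"] assms act_inv' act_closed inv_in by simp
    then show "t \<in> d x ` (M - U)"
      using z assms invariant_iff inv_in act_closed by blast
  next
    fix t assume "t \<in> d x ` (M - U)"
    then obtain z where z: "z \<in> M" "z \<notin> U" "t = d x z"
      by blast
    then have "t = d (\<phi> g x) (\<phi> g z)"
      using isometry assms by simp
    then show "t \<in> d (\<phi> g x) ` (M - U)"
      using z assms invariant_iff act_closed by blast
  qed
  then show ?thesis
    by (simp add: depth_def)
qed

lemma shrink_invariant:
  assumes "\<And>s. s \<in> S \<Longrightarrow> invariant (U s)" "s \<in> S"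
  shows "invariant (shrink S U s)"
  unfolding invariant_def shrink_def
  using assms by (auto simp: act_closed depth_invariant cong: SUP_cong)

lemma mball_image:
  assumes "g \<in> carrier G" "x \<in> M"
  shows "y \<in> mball (\<phi> g x) r \<longleftrightarrow> y \<in> M \<and> \<phi> (inv g) y \<in> mball x r"
  using assms isometry[of g x "\<phi> (inv g) y"]
  by (auto simp: act_inv' act_closed inv_in)

lemma mball_Int_invariant:
  assumes "invariant A" "g \<in> carrier G" "x \<in> M"
  shows "A \<inter> mball (\<phi> g x) r \<noteq> {} \<longleftrightarrow> A \<inter> mball x r \<noteq> {}"
proof
  assume "A \<inter> mball (\<phi> g x) r \<noteq> {}"
  then obtain y where "y \<in> A" "y \<in> mball (\<phi> g x) r"
    by blast
  then have "\<phi> (inv g) y \<in> A \<inter> mball x r"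
    using assms mball_image inv_in unfolding invariant_def by blast
  then show "A \<inter> mball x r \<noteq> {}"
    by blast
next
  assume "A \<inter> mball x r \<noteq> {}"
  then obtain y where "y \<in> A" "y \<in> mball x r"
    by blast
  then have "\<phi> g y \<in> A \<inter> mball (\<phi> g x) r"
    using assms isometry[of g x y] unfolding invariant_def by (auto simp: act_closed)
  then show "A \<inter> mball (\<phi> g x) r \<noteq> {}"
    by blast
qed

lemma swell_invariant:
  assumes F: "\<And>s. s \<in> S \<Longrightarrow> invariant (F s)" and s: "s \<in> S"
  shows "invariant (swell S F s)"
  unfolding invariant_def
proof (intro conjI ballI)
  fix g y assume g: "g \<in> carrier G" and "y \<in> swell S F s"
  then obtain x where x: "x \<in> F s" "x \<in> M" "y \<in> M" "d x y < isolating_radius S F x / 2"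
    unfolding swell_def by auto
  have "isolating_radius S F (\<phi> g x) = isolating_radius S F x"
    unfolding isolating_radius_def
    using F g x(2) by (simp add: mball_Int_invariant invariant_iff)
  then have "\<phi> g y \<in> mball (\<phi> g x) (isolating_radius S F (\<phi> g x) / 2)"
    using x g isometry by (simp add: act_closed)
  moreover have "\<phi> g x \<in> F s"
    using F[OF s] g x unfolding invariant_def by blast
  ultimately show "\<phi> g y \<in> swell S F s"
    unfolding swell_def by blast
qed (auto simp: swell_def)

text \<open>
  The relative form of \<open>dim (A/G) < N\<close>: covers are of all of \<open>M\<close>, but only their order on \<open>A\<close> is
  controlled. Covers and refinements share the index set \<open>S\<close>, so that refinements can be iterated
  and intersected index by index.
\<close>
definition thinnable :: "'s set \<Rightarrow> nat \<Rightarrow> 'a set \<Rightarrow> bool" where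
  "thinnable S N A \<longleftrightarrow> (\<forall>U. invariant_open_cover S U \<longrightarrow>
     (\<exists>V. invariant_open_cover S V \<and> (\<forall>s\<in>S. V s \<subseteq> U s) \<and>
          (\<forall>x\<in>A. at_most N {s\<in>S. x \<in> V s})))"

text \<open>
  Starting from \<open>U\<close>, thin the cover on \<open>A 0\<close>, shrink it, thin the result on \<open>A 1\<close>, shrink again, and so
  on, and let \<open>F s\<close> be the intersection of the sets obtained for the index \<open>s\<close>. A point of \<open>A i\<close> lies
  in at most \<open>N\<close> of the sets after stage \<open>i\<close>, so some index survives for ever and the \<open>F s\<close> cover \<open>M\<close>
  with order at most \<open>N\<close>. The shrinking at each stage makes the family \<open>F\<close> closed and locally finite,
  hence it swells to an open cover of the same order.
\<close>
theorem countable_sum: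
  fixes A :: "nat \<Rightarrow> 'a set"
  assumes A: "(\<Union>i. A i) = M" and thin: "\<And>i. thinnable S N (A i)"
  shows "thinnable S N M"
  unfolding thinnable_def
proof (intro allI impI)
  fix U :: "'b \<Rightarrow> 'a set" assume U: "invariant_open_cover S U"
  define step where "step i V W \<longleftrightarrow>
    (\<forall>s\<in>S. W s \<subseteq> V s) \<and>
    (\<forall>x\<in>M. \<exists>e>0. \<forall>s\<in>S. W s \<inter> mball x e \<noteq> {} \<longrightarrow> x \<in> V s) \<and>
    (\<forall>x\<in>A i. \<exists>e>0. \<exists>T. at_most N T \<and> (\<forall>s\<in>S. W s \<inter> mball x e \<noteq> {} \<longrightarrow> s \<in> T))"
    for i and V W :: "'b \<Rightarrow> 'a set"
  have ex_step: "\<exists>W. invariant_open_cover S W \<and> step i V W" if V: "invariant_open_cover S V" for i V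
  proof -
    obtain V' where V': "invariant_open_cover S V'" "\<forall>s\<in>S. V' s \<subseteq> V s"
      "\<forall>x\<in>A i. at_most N {s\<in>S. x \<in> V' s}"
      using thin[of i] V unfolding thinnable_def by blast
    then have op: "\<And>s. s \<in> S \<Longrightarrow> openin mtopology (V' s)" and cov: "(\<Union>s\<in>S. V' s) = M"
      and inv: "\<And>s. s \<in> S \<Longrightarrow> invariant (V' s)"
      unfolding invariant_open_cover_def by auto
    note sh = shrink_properties[of S V', OF op cov]
    have "invariant_open_cover S (shrink S V')"
      unfolding invariant_open_cover_def by (intro conjI ballI sh(1,2) shrink_invariant inv)
    moreover have "step i V (shrink S V')"
      unfolding step_def
    proof (intro conjI ballI)
      fix s assume s: "s \<in> S"
      show "shrink S V' s \<subseteq> V s"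
      proof
        fix x assume x: "x \<in> shrink S V' s"
        then have "x \<in> M"
          by (simp add: shrink_def)
        then obtain e where "0 < e" "\<forall>s\<in>S. shrink S V' s \<inter> mball x e \<noteq> {} \<longrightarrow> x \<in> V' s"
          using sh(3) by blast
        moreover from this have "x \<in> shrink S V' s \<inter> mball x e"
          using x \<open>x \<in> M\<close> by simp
        ultimately show "x \<in> V s"
          using s V'(2) by blast
      qed
    next
      fix x assume "x \<in> M"
      then obtain e where "0 < e" "\<forall>s\<in>S. shrink S V' s \<inter> mball x e \<noteq> {} \<longrightarrow> x \<in> V' s"
        using sh(3) by blast
      then show "\<exists>e>0. \<forall>s\<in>S. shrink S V' s \<inter> mball x e \<noteq> {} \<longrightarrow> x \<in> V s"
        using V'(2) by (intro exI[of _ e]) blast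
    next
      fix x assume x: "x \<in> A i"
      then have "x \<in> M"
        using A by blast
      then obtain e where "0 < e" "\<forall>s\<in>S. shrink S V' s \<inter> mball x e \<noteq> {} \<longrightarrow> x \<in> V' s"
        using sh(3) by blast
      then show "\<exists>e>0. \<exists>T. at_most N T \<and> (\<forall>s\<in>S. shrink S V' s \<inter> mball x e \<noteq> {} \<longrightarrow> s \<in> T)"
        using V'(3) x by (intro exI[of _ e] conjI exI[of _ "{s\<in>S. x \<in> V' s}"]) auto
    qed
    ultimately show ?thesis
      by blast
  qed
  obtain V where V0: "V 0 = U" and V: "\<And>i. invariant_open_cover S (V i)"
    and st: "\<And>i. step i (V i) (V (Suc i))"
  proof -
    have "\<exists>f. \<forall>i. (invariant_open_cover S (f i) \<and> (i = 0 \<longrightarrow> f i = U)) \<and> step i (f i) (f (Suc i))"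
      by (rule dependent_nat_choice) (use U ex_step in auto)
    then show ?thesis
      using that by blast
  qed
  have dec: "V k s \<subseteq> V i s" if "i \<le> k" "s \<in> S" for i k s
    using that(1)
  proof (induction k rule: dec_induct)
    case (step k)
    then show ?case
      using st[of k] that(2) unfolding step_def by blast
  qed auto
  define F where "F s = (\<Inter>i. V i s)" for s
  have FM: "F s \<subseteq> M" if "s \<in> S" for s
    using V[of 0] that unfolding F_def invariant_open_cover_def by blast
  have Finv: "invariant (F s)" if "s \<in> S" for s
    using V FM[OF that] that unfolding invariant_def F_def invariant_open_cover_def by blast
  have local: "\<exists>e>0. \<exists>T i. at_most N T \<and> (\<forall>s\<in>S. V i s \<inter> mball x e \<noteq> {} \<longrightarrow> s \<in> T)" if x: "x \<in> M" for x
  proof -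
    obtain i where "x \<in> A i"
      using A x by blast
    then show ?thesis
      using st[of i] unfolding step_def by meson
  qed
  have Fnear: "\<exists>e>0. \<forall>s\<in>S. F s \<inter> mball x e \<noteq> {} \<longrightarrow> x \<in> F s" if x: "x \<in> M" for x
  proof -
    obtain e T i where e: "0 < e" "at_most N T" "\<forall>s\<in>S. V i s \<inter> mball x e \<noteq> {} \<longrightarrow> s \<in> T"
      using local[OF x] by blast
    have "\<exists>e>0. s \<in> S \<longrightarrow> F s \<inter> mball x e \<noteq> {} \<longrightarrow> x \<in> F s" for s
    proof (cases "s \<in> S \<and> x \<notin> F s")
      case True
      then obtain k where "x \<notin> V k s"
        by (auto simp: F_def)
      moreover obtain e where "0 < e" "\<forall>s\<in>S. V (Suc k) s \<inter> mball x e \<noteq> {} \<longrightarrow> x \<in> V k s"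
        using st[of k] x unfolding step_def by blast
      ultimately show ?thesis
        using True unfolding F_def by blast
    qed (auto intro: exI[of _ 1])
    then obtain b where b: "\<And>s. 0 < b s" "\<And>s. s \<in> S \<Longrightarrow> F s \<inter> mball x (b s) \<noteq> {} \<Longrightarrow> x \<in> F s"
      by metis
    define r where "r = Min (insert e (b ` T))"
    have fin: "finite (insert e (b ` T))"
      using e by (simp add: at_most_def)
    have r: "0 < r" "r \<le> e" "\<And>s. s \<in> T \<Longrightarrow> r \<le> b s"
      using fin b(1) e(1) unfolding r_def by (auto simp: Min_gr_iff)
    have "x \<in> F s" if s: "s \<in> S" "F s \<inter> mball x r \<noteq> {}" for s
    proof -
      have "V i s \<inter> mball x e \<noteq> {}"
        using s(2) mball_subset_concentric[OF r(2), of x] unfolding F_def by blast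
      then have "s \<in> T"
        using e s by blast
      then have "F s \<inter> mball x (b s) \<noteq> {}"
        using s(2) mball_subset_concentric[OF r(3), of s x] by blast
      then show ?thesis
        using b(2) s by blast
    qed
    then show ?thesis
      using r(1) by blast
  qed
  have Ford: "at_most N {s\<in>S. x \<in> F s}" and Fcov: "\<exists>s\<in>S. x \<in> F s" if x: "x \<in> M" for x
  proof -
    obtain e T i where e: "0 < e" "at_most N T" "\<forall>s\<in>S. V i s \<inter> mball x e \<noteq> {} \<longrightarrow> s \<in> T"
      using local[OF x] by blast
    have T: "s \<in> T" if "s \<in> S" "x \<in> V i s" for s
    proof -
      have "x \<in> V i s \<inter> mball x e"
        using that(2) x e(1) by simp
      then show ?thesis
        using e(3) that(1) by blast
    qed
    show "at_most N {s\<in>S. x \<in> F s}"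
      using e(2) by (rule at_most_mono) (auto simp: F_def T)
    show "\<exists>s\<in>S. x \<in> F s"
    proof (rule ccontr)
      assume "\<not> ?thesis"
      then have "\<forall>s\<in>S. \<exists>k. x \<notin> V k s"
        by (auto simp: F_def)
      then obtain k where k: "\<And>s. s \<in> S \<Longrightarrow> x \<notin> V (k s) s"
        by metis
      define m where "m = Max (insert i (k ` T))"
      have fin: "finite (insert i (k ` T))"
        using e by (simp add: at_most_def)
      have m: "i \<le> m" "\<And>s. s \<in> T \<Longrightarrow> k s \<le> m"
        using fin unfolding m_def by auto
      obtain s where s: "s \<in> S" "x \<in> V m s"
        using V[of m] x unfolding invariant_open_cover_def by blast
      then have "s \<in> T"
        using T dec[OF m(1)] by blast
      then show False
        using k[OF s(1)] dec[OF m(2)] s by blast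
    qed
  qed
  have sw: "openin mtopology (swell S F s)" "s \<in> S \<Longrightarrow> F s \<subseteq> swell S F s"
    "y \<in> M \<Longrightarrow> at_most N {s\<in>S. y \<in> swell S F s}" for s y
    using swell_properties[of S F N] FM Fnear Ford by simp_all
  define W where "W s = swell S F s \<inter> U s" for s
  have "invariant_open_cover S W"
    unfolding invariant_open_cover_def
  proof (intro conjI ballI)
    fix s assume s: "s \<in> S"
    then show "openin mtopology (W s)"
      unfolding W_def using U sw(1) by (auto simp: invariant_open_cover_def)
    show "invariant (W s)"
      using U swell_invariant[of S F s] Finv s
      unfolding W_def invariant_open_cover_def invariant_def by blast
  next
    show "(\<Union>s\<in>S. W s) = M"
    proof
      show "(\<Union>s\<in>S. W s) \<subseteq> M"
        unfolding W_def swell_def by auto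
      show "M \<subseteq> (\<Union>s\<in>S. W s)"
      proof
        fix x assume "x \<in> M"
        then obtain s where "s \<in> S" "x \<in> F s"
          using Fcov by blast
        then show "x \<in> (\<Union>s\<in>S. W s)"
          using sw(2) V0 unfolding W_def F_def by blast
      qed
    qed
  qed
  moreover have "at_most N {s\<in>S. x \<in> W s}" if "x \<in> M" for x
    using sw(3)[OF that] by (rule at_most_mono) (auto simp: W_def)
  moreover have "W s \<subseteq> U s" for s
    by (simp add: W_def)
  ultimately show "\<exists>V. invariant_open_cover S V \<and> (\<forall>s\<in>S. V s \<subseteq> U s) \<and>
      (\<forall>x\<in>M. at_most N {s\<in>S. x \<in> V s})"
    by (intro exI[of _ W] conjI ballI)
qed


section \<open>Actions with discrete orbits\<close>

text \<open>
  These closed sets, for \<open>\<eta> = 1, 1/2, 1/3, ...\<close>, play the part of a stratification of \<open>M\<close> by orbit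
  type, although stabilisers of different sizes occur in the same set.
\<close>
definition orbit_gap :: "real \<Rightarrow> 'a set" where
  "orbit_gap \<eta> = {x\<in>M. \<forall>g\<in>carrier G. \<phi> g x = x \<or> \<eta> \<le> d x (\<phi> g x)}"

text \<open>
  A displacement strictly between \<open>0\<close> and \<open>\<eta>\<close> persists for the same group element at nearby points.
\<close>
lemma closedin_orbit_gap: "closedin mtopology (orbit_gap \<eta>)"
proof (rule closedin_metric_limit)
  fix x assume x: "x \<in> M" and lim: "\<And>e. 0 < e \<Longrightarrow> \<exists>y\<in>orbit_gap \<eta>. d x y < e"
  have "\<eta> \<le> d x (\<phi> g x)" if g: "g \<in> carrier G" and ne: "\<phi> g x \<noteq> x" for g
  proof (rule ccontr)
    assume less: "\<not> \<eta> \<le> d x (\<phi> g x)"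
    define p where "p = d x (\<phi> g x)"
    have gx: "\<phi> g x \<in> M"
      using act_closed g x by blast
    have p: "0 < p" "p < \<eta>"
      using ne less x gx unfolding p_def by (auto simp: mdist_pos_less)
    obtain y where y: "y \<in> orbit_gap \<eta>" "d x y < min p (\<eta> - p) / 2"
      using lim[of "min p (\<eta> - p) / 2"] p by auto
    then have yM: "y \<in> M" and gy: "\<phi> g y \<in> M" and iso: "d (\<phi> g x) (\<phi> g y) = d x y"
      using act_closed isometry g x unfolding orbit_gap_def by auto
    have "p \<le> d x y + d y (\<phi> g y) + d x y"
      using triangle[OF x yM gx] triangle[OF yM gy gx] iso unfolding p_def by (simp add: commute)
    moreover have "d y (\<phi> g y) \<le> d x y + p + d x y"
      using triangle[OF yM x gy] triangle[OF x gx gy] iso unfolding p_def by (simp add: commute)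
    ultimately have "0 < d y (\<phi> g y)" "d y (\<phi> g y) < \<eta>"
      using y(2) by (auto simp: min_def split: if_splits)
    then show False
      using y(1) g yM unfolding orbit_gap_def by fastforce
  qed
  then show "x \<in> orbit_gap \<eta>"
    using x by (auto simp: orbit_gap_def)
qed (auto simp: orbit_gap_def)

lemma orbit_gapD:
  assumes "x \<in> orbit_gap \<eta>" "g \<in> carrier G" "d x (\<phi> g x) < \<eta>"
  shows "\<phi> g x = x"
  using assms unfolding orbit_gap_def by fastforce

text \<open>
  The preimage of an \<open>\<epsilon>\<close>-ball of the orbit space.
\<close>

definition tube :: "real \<Rightarrow> 'a \<Rightarrow> 'a set" where
  "tube \<epsilon> y = {x\<in>M. \<exists>g\<in>carrier G. d (\<phi> g x) y < \<epsilon>}"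

lemma openin_tube:
  assumes "y \<in> M"
  shows "openin mtopology (tube \<epsilon> y)"
  unfolding openin_mtopology
proof (intro conjI allI impI)
  fix x assume "x \<in> tube \<epsilon> y"
  then obtain g where x: "x \<in> M" and g: "g \<in> carrier G" "d (\<phi> g x) y < \<epsilon>"
    unfolding tube_def by blast
  have "mball x (\<epsilon> - d (\<phi> g x) y) \<subseteq> tube \<epsilon> y"
  proof
    fix z assume z: "z \<in> mball x (\<epsilon> - d (\<phi> g x) y)"
    then have "d (\<phi> g z) y \<le> d x z + d (\<phi> g x) y"
      using triangle[of "\<phi> g z" "\<phi> g x" y] isometry[of g z x] act_closed g x assms
      by (auto simp: commute)
    then show "z \<in> tube \<epsilon> y"
      using z g unfolding tube_def by (intro CollectI conjI bexI[of _ g]) auto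
  qed
  then show "\<exists>r>0. mball x r \<subseteq> tube \<epsilon> y"
    using g by (intro exI[of _ "\<epsilon> - d (\<phi> g x) y"]) auto
qed (auto simp: tube_def)

lemma tube_act_iff:
  assumes "g \<in> carrier G" "x \<in> M"
  shows "\<phi> g x \<in> tube \<epsilon> y \<longleftrightarrow> x \<in> tube \<epsilon> y"
proof -
  interpret group G by (rule group_G)
  have "x \<in> tube \<epsilon> y" if gx: "\<phi> g x \<in> tube \<epsilon> y" and g: "g \<in> carrier G" and x: "x \<in> M" for g x
  proof -
    obtain h where h: "h \<in> carrier G" "d (\<phi> h (\<phi> g x)) y < \<epsilon>"
      using gx unfolding tube_def by blast
    then show ?thesis
      using g x act_mult unfolding tube_def by (intro CollectI conjI bexI[of _ "h \<otimes> g"]) auto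
  qed
  from this[of g x] this[of "inv g" "\<phi> g x"] show ?thesis
    using assms act_inv act_closed by auto
qed

text \<open>
  The slice \<open>B\<close> is a closed copy of \<open>A/G\<close> inside \<open>M\<close>: every orbit of \<open>A\<close> meets it once. Since \<open>B\<close> is
  also open in \<open>A\<close>, the translates of a set open in \<open>B\<close> form a set open in \<open>A\<close>, and sets that are
  thin on \<open>B\<close> remain so after saturation, as each orbit is tested at a single point.
\<close>
lemma thinnable_of_slice:
  fixes S :: "'s set"
  assumes dim: "covering_dim_le mtopology n"
    and A: "closedin mtopology A" "invariant A"
    and B: "closedin mtopology B" "B \<subseteq> A"
    and meets: "\<And>x. x \<in> A \<Longrightarrow> \<exists>g\<in>carrier G. \<phi> g x \<in> B"
    and once: "\<And>x g. x \<in> B \<Longrightarrow> g \<in> carrier G \<Longrightarrow> \<phi> g x \<in> B \<Longrightarrow> \<phi> g x = x"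
    and rel_open: "\<And>x. x \<in> B \<Longrightarrow> \<exists>e>0. A \<inter> mball x e \<subseteq> B"
  shows "thinnable S (nat (n + 1)) A"
  unfolding thinnable_def
proof (intro allI impI)
  interpret group G by (rule group_G)
  fix U :: "'s \<Rightarrow> 'a set" assume U: "invariant_open_cover S U"
  have AM: "A \<subseteq> M" and BM: "B \<subseteq> M"
    using A B by (auto simp: invariant_def)
  have Uop: "\<And>s. s \<in> S \<Longrightarrow> openin mtopology (U s)" and Uinv: "\<And>s. s \<in> S \<Longrightarrow> invariant (U s)"
    and Ucov: "(\<Union>s\<in>S. U s) = M"
    using U by (auto simp: invariant_open_cover_def)
  obtain V where V: "\<And>s. s \<in> S \<Longrightarrow> openin mtopology (V s)" "\<And>s. s \<in> S \<Longrightarrow> V s \<subseteq> U s"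
    "B \<subseteq> (\<Union>s\<in>S. V s)" "\<And>x. x \<in> M \<Longrightarrow> at_most (nat (n + 1)) {s\<in>S. x \<in> V s}"
  proof (rule closed_subset_thin[OF dim B(1), of S U])
    show "B \<subseteq> (\<Union>s\<in>S. U s)"
      using BM Ucov by blast
  qed (use Uop in blast, rule that)
  \<comment> \<open>The cover is altered on \<open>A\<close> only, where it becomes the saturation of \<open>B \<inter> V s\<close>.\<close>
  define P where "P s = {x\<in>A. \<exists>g\<in>carrier G. \<phi> g x \<in> B \<inter> V s}" for s
  define W where "W s = (U s - A) \<union> P s" for s
  have PU: "P s \<subseteq> U s" if "s \<in> S" for s
    using V(2)[OF that] invariant_iff[OF Uinv[OF that]] AM unfolding P_def by blast
  have Pinv: "\<phi> g x \<in> P s" if x: "x \<in> P s" and g: "g \<in> carrier G" for x g s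
  proof -
    obtain h where h: "h \<in> carrier G" "\<phi> h x \<in> B \<inter> V s" and xA: "x \<in> A"
      using x unfolding P_def by blast
    have "\<phi> (h \<otimes> inv g) (\<phi> g x) = \<phi> h x"
      using xA AM h g by (simp add: act_mult act_inv act_closed subsetD)
    moreover have "\<phi> g x \<in> A"
      using A(2) xA g unfolding invariant_def by blast
    ultimately show ?thesis
      using h g unfolding P_def by (intro CollectI conjI bexI[of _ "h \<otimes> inv g"]) auto
  qed
  have "invariant_open_cover S W"
    unfolding invariant_open_cover_def
  proof (intro conjI ballI)
    fix s assume s: "s \<in> S"
    show "openin mtopology (W s)"
      unfolding openin_mtopology
    proof (intro conjI allI impI)
      show "W s \<subseteq> M"
        using openin_subset[OF Uop[OF s]] AM unfolding W_def P_def by auto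
      fix x assume "x \<in> W s"
      then consider "x \<in> U s - A" | "x \<in> P s"
        unfolding W_def by blast
      then show "\<exists>r>0. mball x r \<subseteq> W s"
      proof cases
        case 1
        have "openin mtopology (U s - A)"
          using Uop[OF s] A(1) by (rule openin_diff)
        with 1 show ?thesis
          unfolding W_def openin_mtopology by blast
      next
        case 2
        then obtain h where h: "h \<in> carrier G" "\<phi> h x \<in> B" "\<phi> h x \<in> V s" and xA: "x \<in> A"
          unfolding P_def by blast
        have xM: "x \<in> M"
          using xA AM by blast
        obtain e1 where e1: "0 < e1" "A \<inter> mball (\<phi> h x) e1 \<subseteq> B"
          using rel_open[OF h(2)] by blast
        obtain e2 where e2: "0 < e2" "mball (\<phi> h x) e2 \<subseteq> V s"
          using V(1)[OF s] h(3) unfolding openin_mtopology by blast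
        obtain e3 where e3: "0 < e3" "mball x e3 \<subseteq> U s"
          using Uop[OF s] PU[OF s] 2 unfolding openin_mtopology by blast
        have "mball x (min e1 (min e2 e3)) \<subseteq> W s"
        proof
          fix z assume z: "z \<in> mball x (min e1 (min e2 e3))"
          show "z \<in> W s"
          proof (cases "z \<in> A")
            case True
            have "\<phi> h z \<in> mball (\<phi> h x) e1" "\<phi> h z \<in> mball (\<phi> h x) e2"
              using z h(1) isometry[of h x z] act_closed by auto
            then have "\<phi> h z \<in> B \<inter> V s"
              using e1 e2 True A(2) h(1) unfolding invariant_def by blast
            then show ?thesis
              using True h(1) unfolding W_def P_def by blast
          next
            case False
            then show ?thesis
              using z e3 unfolding W_def by auto
          qed
        qed
        then show ?thesis
          using e1 e2 e3 by (intro exI[of _ "min e1 (min e2 e3)"]) auto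
      qed
    qed
    show "invariant (W s)"
      unfolding invariant_def
    proof (intro conjI ballI)
      show "W s \<subseteq> M"
        using openin_subset[OF Uop[OF s]] AM unfolding W_def P_def by auto
      fix g x assume g: "g \<in> carrier G" and "x \<in> W s"
      then show "\<phi> g x \<in> W s"
        using Pinv[OF _ g] invariant_iff[OF A(2) g] invariant_iff[OF Uinv[OF s] g]
          \<open>W s \<subseteq> M\<close> unfolding W_def by blast
    qed
  next
    show "(\<Union>s\<in>S. W s) = M"
    proof
      show "(\<Union>s\<in>S. W s) \<subseteq> M"
        using Ucov AM unfolding W_def P_def by blast
      show "M \<subseteq> (\<Union>s\<in>S. W s)"
      proof
        fix x assume x: "x \<in> M"
        show "x \<in> (\<Union>s\<in>S. W s)"
        proof (cases "x \<in> A")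
          case True
          then obtain g where g: "g \<in> carrier G" "\<phi> g x \<in> B"
            using meets by blast
          then obtain s where "s \<in> S" "\<phi> g x \<in> V s"
            using V(3) by blast
          then show ?thesis
            using True g unfolding W_def P_def by blast
        next
          case False
          then show ?thesis
            using x Ucov unfolding W_def by blast
        qed
      qed
    qed
  qed
  moreover have "W s \<subseteq> U s" if "s \<in> S" for s
    using PU[OF that] unfolding W_def by blast
  moreover have "at_most (nat (n + 1)) {s\<in>S. x \<in> W s}" if xA: "x \<in> A" for x
  proof -
    have xM: "x \<in> M"
      using xA AM by blast
    obtain h where h: "h \<in> carrier G" "\<phi> h x \<in> B"
      using meets[OF xA] by blast
    have "\<phi> h x \<in> V s" if xW: "x \<in> W s" for s
    proof -
      obtain g where g: "g \<in> carrier G" "\<phi> g x \<in> B" "\<phi> g x \<in> V s"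
        using xW xA unfolding W_def P_def by blast
      have "\<phi> (g \<otimes> inv h) (\<phi> h x) = \<phi> g x"
        using xM h g by (simp add: act_mult act_inv act_closed)
      then have "\<phi> g x = \<phi> h x"
        using once[of "\<phi> h x" "g \<otimes> inv h"] h g by simp
      then show ?thesis
        using g by simp
    qed
    then show ?thesis
      using V(4)[OF act_closed[OF h(1) xM]] by (rule_tac at_most_mono) auto
  qed
  ultimately show "\<exists>W. invariant_open_cover S W \<and> (\<forall>s\<in>S. W s \<subseteq> U s) \<and>
      (\<forall>x\<in>A. at_most (nat (n + 1)) {s\<in>S. x \<in> W s})"
    by blast
qed

text \<open>
  Points of the slice lie within \<open>\<eta>/2\<close> of the centre \<open>c x\<close> chosen for their orbit, so two of them in
  the same orbit are less than \<open>\<eta>\<close> apart and coincide. This also makes the slice closed: a limit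
  point is less than \<open>\<eta>\<close> away from its own translate in the slice.
\<close>
lemma thinnable_pieces:
  assumes dim: "covering_dim_le mtopology n" and \<eta>: "0 < \<eta>"
  obtains C :: "nat \<Rightarrow> 'a set" where "(\<Union>m. C m) = orbit_gap \<eta>"
    and "\<And>m. thinnable S (nat (n + 1)) (C m)"
proof -
  interpret group G by (rule group_G)
  define \<epsilon> where "\<epsilon> = \<eta> / 2"
  have \<epsilon>: "0 < \<epsilon>"
    using \<eta> by (simp add: \<epsilon>_def)
  have "(\<Union>y\<in>M. tube \<epsilon> y) = M"
  proof
    show "M \<subseteq> (\<Union>y\<in>M. tube \<epsilon> y)"
    proof
      fix x assume x: "x \<in> M"
      then have "x \<in> tube \<epsilon> x"
        unfolding tube_def using \<epsilon> by (intro CollectI conjI bexI[of _ \<one>]) (auto simp: act_one)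
      with x show "x \<in> (\<Union>y\<in>M. tube \<epsilon> y)"
        by blast
    qed
  qed (auto simp: tube_def)
  note Q = discrete_pieces[of M "tube \<epsilon>", OF openin_tube this]
  obtain c where c: "\<And>x. x \<in> M \<Longrightarrow> c x \<in> M \<and> x \<in> tube \<epsilon> (c x)"
    and c_eq: "\<And>x y. (\<forall>i\<in>M. x \<in> tube \<epsilon> i \<longleftrightarrow> y \<in> tube \<epsilon> i) \<Longrightarrow> c x = c y"
    and cl: "\<And>r. 0 < r \<Longrightarrow> closedin mtopology {x\<in>M. mball x r \<subseteq> tube \<epsilon> (c x)}"
    and sep: "\<And>x y r. x \<in> M \<Longrightarrow> y \<in> M \<Longrightarrow> mball x r \<subseteq> tube \<epsilon> (c x) \<Longrightarrow>
        mball y r \<subseteq> tube \<epsilon> (c y) \<Longrightarrow> d x y < r \<Longrightarrow> c x = c y"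
    by (rule Q) (assumption, rule that, blast+)
  have c_act: "c (\<phi> g x) = c x" if "g \<in> carrier G" "x \<in> M" for g x
    using c_eq tube_act_iff that by blast
  define C where "C m = orbit_gap \<eta> \<inter> {x\<in>M. mball x (1 / real (Suc m)) \<subseteq> tube \<epsilon> (c x)}"
    for m :: nat
  show ?thesis
  proof (rule that[of C])
    have "orbit_gap \<eta> \<subseteq> (\<Union>m. C m)"
    proof
      fix x assume x: "x \<in> orbit_gap \<eta>"
      then have xM: "x \<in> M"
        by (simp add: orbit_gap_def)
      then obtain r where r: "0 < r" "mball x r \<subseteq> tube \<epsilon> (c x)"
        using openin_tube c unfolding openin_mtopology by meson
      obtain m where "1 / real (Suc m) < r"
        using r(1) nat_approx_posE by blast
      then have "x \<in> C m"
        using x xM r mball_subset_concentric[of "1 / real (Suc m)" r x] unfolding C_def by auto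
      then show "x \<in> (\<Union>m. C m)"
        by blast
    qed
    then show "(\<Union>m. C m) = orbit_gap \<eta>"
      unfolding C_def by blast
  next
    fix m
    let ?r = "1 / real (Suc m)"
    define B where "B = {x\<in>C m. d x (c x) < \<epsilon>}"
    have CM: "x \<in> M" "x \<in> orbit_gap \<eta>" "mball x ?r \<subseteq> tube \<epsilon> (c x)" "c x \<in> M" if "x \<in> C m" for x
      using that c unfolding C_def by auto
    have sepC: "c x = c y" if "x \<in> C m" "y \<in> C m" "d x y < ?r" for x y
      using sep CM that by metis
    have C_act: "\<phi> g x \<in> C m" if x: "x \<in> C m" and g: "g \<in> carrier G" for x g
    proof -
      have xM: "x \<in> M" and gxM: "\<phi> g x \<in> M"
        using CM x act_closed g by auto
      have "\<phi> g x \<in> orbit_gap \<eta>"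
        unfolding orbit_gap_def
      proof (intro CollectI conjI ballI gxM)
        fix h assume h: "h \<in> carrier G"
        define k where "k = inv g \<otimes> h \<otimes> g"
        have k: "k \<in> carrier G"
          using g h by (simp add: k_def)
        have "\<phi> g (\<phi> k x) = \<phi> h (\<phi> g x)"
          using g h xM by (simp add: k_def act_mult act_closed act_inv')
        moreover have "d (\<phi> g x) (\<phi> g (\<phi> k x)) = d x (\<phi> k x)"
          using isometry g xM act_closed k by blast
        moreover have "\<phi> k x = x \<or> \<eta> \<le> d x (\<phi> k x)"
          using CM(2)[OF x] k unfolding orbit_gap_def by blast
        ultimately show "\<phi> h (\<phi> g x) = \<phi> g x \<or> \<eta> \<le> d (\<phi> g x) (\<phi> h (\<phi> g x))"
          by metis
      qed
      moreover have "mball (\<phi> g x) ?r \<subseteq> tube \<epsilon> (c (\<phi> g x))"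
      proof
        fix z assume "z \<in> mball (\<phi> g x) ?r"
        then have z: "z \<in> M" "\<phi> (inv g) z \<in> mball x ?r"
          using mball_image g xM by blast+
        then have "\<phi> (inv g) z \<in> tube \<epsilon> (c x)"
          using CM(3)[OF x] by blast
        then show "z \<in> tube \<epsilon> (c (\<phi> g x))"
          using tube_act_iff[OF inv_in[OF g] z(1)] c_act[OF g xM] by simp
      qed
      ultimately show ?thesis
        using gxM unfolding C_def by blast
    qed
    have meets: "\<exists>g\<in>carrier G. \<phi> g x \<in> B" if x: "x \<in> C m" for x
    proof -
      obtain g where g: "g \<in> carrier G" "d (\<phi> g x) (c x) < \<epsilon>"
        using c[OF CM(1)[OF x]] unfolding tube_def by blast
      then show ?thesis
        using C_act[OF x] c_act CM(1)[OF x] unfolding B_def by auto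
    qed
    show "thinnable S (nat (n + 1)) (C m)"
    proof (rule thinnable_of_slice[OF dim])
      show Ccl: "closedin mtopology (C m)"
        unfolding C_def by (intro closedin_Int closedin_orbit_gap cl) simp
      show "invariant (C m)"
        unfolding invariant_def using CM C_act by blast
      show "B \<subseteq> C m"
        by (auto simp: B_def)
      show "closedin mtopology B"
      proof (rule closedin_metric_limit)
        show "B \<subseteq> M"
          using CM by (auto simp: B_def)
        fix x assume x: "x \<in> M" and lim: "\<And>e. 0 < e \<Longrightarrow> \<exists>y\<in>B. d x y < e"
        have xC: "x \<in> C m"
        proof (rule ccontr)
          assume "x \<notin> C m"
          then obtain r where "0 < r" "disjnt (C m) (mball x r)"
            using Ccl x unfolding closedin_metric by blast
          moreover obtain y where "y \<in> B" "d x y < r"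
            using lim[OF \<open>0 < r\<close>] by blast
          ultimately show False
            using CM x unfolding B_def disjnt_iff by auto
        qed
        obtain g where g: "g \<in> carrier G" "\<phi> g x \<in> B"
          using meets[OF xC] by blast
        let ?gx = "\<phi> g x"
        have gx: "d ?gx (c x) < \<epsilon>" "?gx \<in> M"
          using g c_act x act_closed unfolding B_def by auto
        \<comment> \<open>Both \<open>x\<close> and its translate are within \<open>\<epsilon> = \<eta>/2\<close> of the centre, up to a small error.\<close>
        obtain y where y: "y \<in> B" "d x y < min ?r (\<epsilon> - d ?gx (c x))"
          using lim[of "min ?r (\<epsilon> - d ?gx (c x))"] gx by auto
        have yC: "y \<in> C m" "d y (c y) < \<epsilon>" "y \<in> M"
          using y CM unfolding B_def by auto
        have cy: "c y = c x"
          using sepC[OF xC yC(1)] y by simp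
        have cM: "c x \<in> M"
          using CM xC by blast
        have "d x ?gx \<le> d x y + d y (c x) + d ?gx (c x)"
          using triangle[OF x yC(3) gx(2)] triangle[OF yC(3) cM gx(2)] by (simp add: commute)
        then have "d x ?gx < \<eta>"
          using y yC(2) cy unfolding \<epsilon>_def by simp
        then have "?gx = x"
          using orbit_gapD[OF CM(2)[OF xC] g(1)] by blast
        then show "x \<in> B"
          using g by simp
      qed
      show "\<exists>g\<in>carrier G. \<phi> g x \<in> B" if "x \<in> C m" for x
        using meets[OF that] .
      show "\<phi> g x = x" if x: "x \<in> B" and g: "g \<in> carrier G" and gx: "\<phi> g x \<in> B" for x g
      proof -
        have xC: "x \<in> C m" "\<phi> g x \<in> C m" "d x (c x) < \<epsilon>" "d (\<phi> g x) (c x) < \<epsilon>"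
          using x gx c_act[OF g] CM unfolding B_def by auto
        have "d x (\<phi> g x) \<le> d x (c x) + d (\<phi> g x) (c x)"
          using triangle[of x "c x" "\<phi> g x"] CM xC by (simp add: commute)
        then have "d x (\<phi> g x) < \<eta>"
          using xC unfolding \<epsilon>_def by simp
        then show ?thesis
          using orbit_gapD[OF CM(2)[OF xC(1)] g] by blast
      qed
      show "\<exists>e>0. C m \<inter> mball x e \<subseteq> B" if x: "x \<in> B" for x
      proof (intro exI conjI)
        let ?e = "min ?r (\<epsilon> - d x (c x))"
        have xC: "x \<in> C m" "d x (c x) < \<epsilon>"
          using x unfolding B_def by auto
        show "0 < ?e"
          using xC by simp
        show "C m \<inter> mball x ?e \<subseteq> B"
        proof
          fix y assume y: "y \<in> C m \<inter> mball x ?e"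
          then have "c y = c x"
            using sepC[OF xC(1), of y] by simp
          moreover have "d y (c x) \<le> d x y + d x (c x)"
            using triangle[of y x "c x"] CM xC(1) y by (auto simp: commute)
          ultimately show "y \<in> B"
            using y unfolding B_def by auto
        qed
      qed
    qed
  qed
qed

theorem invariant_covering_dim:
  assumes dim: "covering_dim_le mtopology n"
    and discrete: "\<And>x. x \<in> M \<Longrightarrow> \<exists>\<eta>>0. x \<in> orbit_gap \<eta>"
  shows "thinnable S (nat (n + 1)) M"
proof -
  have "\<exists>C :: nat \<Rightarrow> 'a set. (\<Union>m. C m) = orbit_gap (1 / real (Suc j)) \<and>
      (\<forall>m. thinnable S (nat (n + 1)) (C m))" for j
    by (rule thinnable_pieces[OF dim, of "1 / real (Suc j)" S]) auto
  then obtain C :: "nat \<Rightarrow> nat \<Rightarrow> 'a set"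
    where C: "\<And>j. (\<Union>m. C j m) = orbit_gap (1 / real (Suc j))"
      "\<And>j m. thinnable S (nat (n + 1)) (C j m)"
    by metis
  define A where "A i = C (fst (prod_decode i)) (snd (prod_decode i))" for i
  show ?thesis
  proof (rule countable_sum[of A])
    show "(\<Union>i. A i) = M"
    proof
      have "C j m \<subseteq> M" for j m
        using C(1)[of j] unfolding orbit_gap_def by blast
      then show "(\<Union>i. A i) \<subseteq> M"
        by (auto simp: A_def)
      show "M \<subseteq> (\<Union>i. A i)"
      proof
        fix x assume x: "x \<in> M"
        then obtain \<eta> where \<eta>: "0 < \<eta>" "x \<in> orbit_gap \<eta>"
          using discrete by blast
        obtain j where "1 / real (Suc j) < \<eta>"
          using \<eta>(1) nat_approx_posE by blast
        then have "x \<in> orbit_gap (1 / real (Suc j))"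
          using \<eta>(2) unfolding orbit_gap_def by force
        then obtain m where "x \<in> C j m"
          using C(1) by blast
        then have "x \<in> A (prod_encode (j, m))"
          by (simp add: A_def)
        then show "x \<in> (\<Union>i. A i)"
          by blast
      qed
    qed
    show "thinnable S (nat (n + 1)) (A i)" for i
      unfolding A_def by (rule C(2))
  qed
qed

text \<open>
  Only finitely many translates of a suitable ball around \<open>x\<close> meet that ball, so only finitely many
  group elements can move \<open>x\<close> a short distance.
\<close>
lemma discrete_orbits_if_proper:
  assumes "proper_action G mtopology \<phi>" "x \<in> M"
  shows "\<exists>\<eta>>0. x \<in> orbit_gap \<eta>"
proof -
  obtain U where U: "openin mtopology U" "x \<in> U" "finite {g\<in>carrier G. \<phi> g ` U \<inter> U \<noteq> {}}"
    using assms unfolding proper_action_def by auto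
  obtain r where r: "0 < r" "mball x r \<subseteq> U"
    using U unfolding openin_mtopology by blast
  let ?K = "{g\<in>carrier G. \<phi> g ` U \<inter> U \<noteq> {} \<and> \<phi> g x \<noteq> x}"
  define \<eta> where "\<eta> = Min (insert r ((\<lambda>g. d x (\<phi> g x)) ` ?K))"
  have fin: "finite (insert r ((\<lambda>g. d x (\<phi> g x)) ` ?K))"
    using U(3) by (auto intro: finite_subset[rotated])
  have "0 < d x (\<phi> g x)" if "g \<in> ?K" for g
    using that assms(2) act_closed by (auto simp: mdist_pos_eq)
  then have "0 < \<eta>"
    using r fin unfolding \<eta>_def by (auto simp: Min_gr_iff)
  moreover have "\<phi> g x = x \<or> \<eta> \<le> d x (\<phi> g x)" if g: "g \<in> carrier G" for g
  proof (cases "g \<in> ?K")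
    case True
    then show ?thesis
      using fin unfolding \<eta>_def by (auto intro!: Min_le)
  next
    case False
    have "r \<le> d x (\<phi> g x)" if "\<phi> g x \<noteq> x"
    proof (rule ccontr)
      assume "\<not> r \<le> d x (\<phi> g x)"
      then have "\<phi> g x \<in> \<phi> g ` U \<inter> U"
        using r U(2) act_closed[OF g assms(2)] assms(2) by auto
      with False g that show False
        by blast
    qed
    moreover have "\<eta> \<le> r"
      using fin unfolding \<eta>_def by auto
    ultimately show ?thesis
      by linarith
  qed
  ultimately show ?thesis
    using assms(2) unfolding orbit_gap_def by blast
qed

section \<open>Refining covers by translates\<close>

lemma image_subset_M: "g \<in> carrier G \<Longrightarrow> U \<subseteq> M \<Longrightarrow> \<phi> g ` U \<subseteq> M"
  using act_closed by blast

lemma image_one: "U \<subseteq> M \<Longrightarrow> \<phi> \<one> ` U = U"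
  using act_one by force

lemma image_mult:
  "g \<in> carrier G \<Longrightarrow> h \<in> carrier G \<Longrightarrow> U \<subseteq> M \<Longrightarrow> \<phi> (g \<otimes> h) ` U = \<phi> g ` \<phi> h ` U"
  unfolding image_image by (intro image_cong refl act_mult) auto

lemma image_Int_invariant:
  assumes "invariant A" "g \<in> carrier G" "U \<subseteq> M"
  shows "\<phi> g ` (A \<inter> U) = A \<inter> \<phi> g ` U"
  using assms invariant_iff by blast

lemma openin_image_act:
  assumes "openin mtopology U" "g \<in> carrier G"
  shows "openin mtopology (\<phi> g ` U)"
  unfolding openin_mtopology
proof (intro conjI allI impI)
  have UM: "U \<subseteq> M"
    using assms openin_subset by fastforce
  then show "\<phi> g ` U \<subseteq> M"
    using image_subset_M assms by blast
  fix y assume "y \<in> \<phi> g ` U"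
  then obtain x where x: "x \<in> U" "y = \<phi> g x"
    by blast
  then obtain r where r: "0 < r" "mball x r \<subseteq> U"
    using assms unfolding openin_mtopology by blast
  have "mball (\<phi> g x) r \<subseteq> \<phi> g ` U"
  proof
    fix z assume "z \<in> mball (\<phi> g x) r"
    then have "z \<in> M" "\<phi> (inv g) z \<in> U"
      using mball_image[OF assms(2)] x(1) UM r by blast+
    then show "z \<in> \<phi> g ` U"
      using act_inv'[OF assms(2)] by (metis imageI)
  qed
  then show "\<exists>r>0. mball y r \<subseteq> \<phi> g ` U"
    using r x by blast
qed

text \<open>
  Translates of \<open>A \<inter> U\<close> are the intersections of \<open>A\<close> with those of \<open>U\<close>. As \<open>A \<inter> U\<close> is nonempty, an
  element that stabilises it moves \<open>U\<close> to a translate meeting \<open>U\<close>, hence to \<open>U\<close>.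
\<close>
lemma F_subset_Int_invariant:
  assumes U: "F_subset G M \<phi> \<F> U" and A: "invariant A" and ne: "A \<inter> U \<noteq> {}"
  shows "F_subset G M \<phi> \<F> (A \<inter> U)"
proof -
  interpret group G by (rule group_G)
  have UM: "U \<subseteq> M" and disj: "\<And>g h. g \<in> carrier G \<Longrightarrow> h \<in> carrier G \<Longrightarrow>
      \<phi> g ` U = \<phi> h ` U \<or> \<phi> g ` U \<inter> \<phi> h ` U = {}"
    and stab: "{g\<in>carrier G. \<phi> g ` U = U} \<in> \<F>"
    using U unfolding F_subset_def by auto
  have im: "\<phi> g ` (A \<inter> U) = A \<inter> \<phi> g ` U" if "g \<in> carrier G" for g
    using image_Int_invariant[OF A that UM] .
  have "\<phi> g ` (A \<inter> U) = A \<inter> U \<longleftrightarrow> \<phi> g ` U = U" if g: "g \<in> carrier G" for g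
    using disj[OF g one_closed] ne unfolding image_one[OF UM] im[OF g] by blast
  then have "{g\<in>carrier G. \<phi> g ` (A \<inter> U) = A \<inter> U} = {g\<in>carrier G. \<phi> g ` U = U}"
    by (intro Collect_cong conj_cong refl)
  moreover have "\<phi> g ` (A \<inter> U) = \<phi> h ` (A \<inter> U) \<or> \<phi> g ` (A \<inter> U) \<inter> \<phi> h ` (A \<inter> U) = {}"
    if "g \<in> carrier G" "h \<in> carrier G" for g h
    using disj[OF that] unfolding im[OF that(1)] im[OF that(2)] by blast
  ultimately show ?thesis
    using UM stab unfolding F_subset_def by auto
qed

lemma open_F_refinement:
  assumes dim: "covering_dim_le mtopology n"
    and proper: "proper_action G mtopology \<phi>"
    and cov: "open_F_cover G mtopology \<phi> \<F> \<U>"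
  shows "\<exists>\<W>. open_F_cover G mtopology \<phi> \<F> \<W> \<and> refines_cover \<W> \<U> \<and>
    family_dim M \<W> \<le> ereal (of_int n)"
proof -
  interpret group G by (rule group_G)
  have Ucov: "\<Union>\<U> = M" and Uop: "\<And>U. U \<in> \<U> \<Longrightarrow> openin mtopology U"
    and UF: "\<And>U. U \<in> \<U> \<Longrightarrow> F_subset G M \<phi> \<F> U"
    and Uact: "\<And>U g. U \<in> \<U> \<Longrightarrow> g \<in> carrier G \<Longrightarrow> \<phi> g ` U \<in> \<U>"
    using cov unfolding open_F_cover_def F_cover_def by auto
  have UM: "U \<subseteq> M" if "U \<in> \<U>" for U
    using that Ucov by blast
  define Sat where "Sat U = (\<Union>g\<in>carrier G. \<phi> g ` U)" for U
  have sub_Sat: "U \<subseteq> Sat U" if "U \<in> \<U>" for U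
    using image_one[OF UM[OF that]] unfolding Sat_def by blast
  have "invariant_open_cover \<U> Sat"
    unfolding invariant_open_cover_def
  proof (intro conjI ballI)
    fix U assume U: "U \<in> \<U>"
    show "openin mtopology (Sat U)"
      unfolding Sat_def using openin_image_act[OF Uop[OF U]] by blast
    show "invariant (Sat U)"
      unfolding invariant_def
    proof (intro conjI ballI)
      show "Sat U \<subseteq> M"
        using image_subset_M[OF _ UM[OF U]] unfolding Sat_def by blast
      fix g x assume g: "g \<in> carrier G" and "x \<in> Sat U"
      then obtain h where h: "h \<in> carrier G" "x \<in> \<phi> h ` U"
        unfolding Sat_def by blast
      then have "\<phi> g x \<in> \<phi> (g \<otimes> h) ` U"
        using image_mult[OF g h(1) UM[OF U]] by blast
      then show "\<phi> g x \<in> Sat U"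
        using m_closed[OF g h(1)] unfolding Sat_def by blast
    qed
  next
    show "\<Union> (Sat ` \<U>) = M"
    proof
      show "\<Union> (Sat ` \<U>) \<subseteq> M"
        using image_subset_M[OF _ UM] unfolding Sat_def by (intro UN_least) blast
      show "M \<subseteq> \<Union> (Sat ` \<U>)"
        using sub_Sat Ucov by blast
    qed
  qed
  then obtain V where V: "invariant_open_cover \<U> V" "\<forall>U\<in>\<U>. V U \<subseteq> Sat U"
    "\<forall>x\<in>M. at_most (nat (n + 1)) {U\<in>\<U>. x \<in> V U}"
    using invariant_covering_dim[OF dim discrete_orbits_if_proper[OF proper]]
    unfolding thinnable_def by blast
  have Vop: "\<And>U. U \<in> \<U> \<Longrightarrow> openin mtopology (V U)" and Vinv: "\<And>U. U \<in> \<U> \<Longrightarrow> invariant (V U)"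
    and Vcov: "(\<Union>U\<in>\<U>. V U) = M"
    using V(1) unfolding invariant_open_cover_def by auto
  \<comment> \<open>The empty set is left out: its stabiliser is all of \<open>G\<close>, which may lie outside \<open>\<F>\<close>.\<close>
  define \<W> where "\<W> = {V U \<inter> \<phi> g ` U | U g. U \<in> \<U> \<and> g \<in> carrier G \<and> V U \<inter> \<phi> g ` U \<noteq> {}}"
  have "open_F_cover G mtopology \<phi> \<F> \<W>"
    unfolding open_F_cover_def F_cover_def topspace_mtopology
  proof (intro conjI ballI)
    show "\<Union>\<W> = M"
    proof
      show "\<Union>\<W> \<subseteq> M"
        using Vcov unfolding \<W>_def by blast
      show "M \<subseteq> \<Union>\<W>"
      proof
        fix x assume "x \<in> M"
        then obtain U where U: "U \<in> \<U>" "x \<in> V U"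
          using Vcov by blast
        then obtain g where "g \<in> carrier G" "x \<in> \<phi> g ` U"
          using V(2) unfolding Sat_def by blast
        then show "x \<in> \<Union>\<W>"
          using U unfolding \<W>_def by blast
      qed
    qed
  next
    fix W assume "W \<in> \<W>"
    then obtain U g where U: "U \<in> \<U>" and g: "g \<in> carrier G" and W: "W = V U \<inter> \<phi> g ` U" "W \<noteq> {}"
      unfolding \<W>_def by blast
    show "F_subset G M \<phi> \<F> W"
      using F_subset_Int_invariant[OF UF[OF Uact[OF U g]] Vinv[OF U]] W by simp
    show "openin mtopology W"
      using Vop[OF U] Uop[OF Uact[OF U g]] W by blast
    fix h assume h: "h \<in> carrier G"
    have "\<phi> h ` W = V U \<inter> \<phi> (h \<otimes> g) ` U"
      using image_Int_invariant[OF Vinv[OF U] h UM[OF Uact[OF U g]]] image_mult[OF h g UM[OF U]] W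
      by simp
    moreover have "\<phi> h ` W \<noteq> {}"
      using W by simp
    ultimately show "\<phi> h ` W \<in> \<W>"
      using U m_closed[OF h g] unfolding \<W>_def
      by (intro CollectI exI[of _ U] exI[of _ "h \<otimes> g"]) simp
  qed
  moreover have "refines_cover \<W> \<U>"
    unfolding refines_cover_def \<W>_def using Uact by blast
  moreover have "family_dim M \<W> \<le> ereal (of_int n)"
    unfolding family_dim_le_iff[OF covering_dim_le_lower_bound[OF dim]]
  proof
    fix x assume x: "x \<in> M"
    \<comment> \<open>The one translate of \<open>U\<close> through \<open>x\<close>, written as a union to avoid choosing \<open>g\<close>.\<close>
    define f where "f U = V U \<inter> (\<Union>g\<in>{g\<in>carrier G. x \<in> \<phi> g ` U}. \<phi> g ` U)" for U
    have "{W\<in>\<W>. x \<in> W} \<subseteq> f ` {U\<in>\<U>. x \<in> V U}"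
    proof
      fix W assume "W \<in> {W\<in>\<W>. x \<in> W}"
      then obtain U g where U: "U \<in> \<U>" "g \<in> carrier G" "W = V U \<inter> \<phi> g ` U" "x \<in> V U" "x \<in> \<phi> g ` U"
        unfolding \<W>_def by blast
      have "\<phi> h ` U = \<phi> g ` U" if "h \<in> carrier G" "x \<in> \<phi> h ` U" for h
        using UF[OF U(1)] U that unfolding F_subset_def by blast
      then have "f U = W"
        using U unfolding f_def by blast
      then show "W \<in> f ` {U\<in>\<U>. x \<in> V U}"
        using U by blast
    qed
    then show "at_most (nat (n + 1)) {W\<in>\<W>. x \<in> W}"
      using at_most_mono[OF at_most_image] V(3) x by blast
  qed
  ultimately show ?thesis
    by blast
qed

end

theorem propositionA8:
  fixes G :: "('g, 'c) monoid_scheme"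
    and M :: "'a set" and d :: "'a \<Rightarrow> 'a \<Rightarrow> real"
    and \<phi> :: "'g \<Rightarrow> 'a \<Rightarrow> 'a"
    and \<F> :: "'g set set" and \<U> :: "'a set set" and n :: int
  assumes "group G"
    and "Metric_space M d"
    and "isometric_action G M d \<phi>"
    and "proper_action G (Metric_space.mtopology M d) \<phi>"
    and "covering_dim (Metric_space.mtopology M d) = ereal (of_int n)"
    and "subgroup_family G \<F>"
    and "open_F_cover G (Metric_space.mtopology M d) \<phi> \<F> \<U>"
  shows "\<exists>\<W>. open_F_cover G (Metric_space.mtopology M d) \<phi> \<F> \<W> \<and>
             refines_cover \<W> \<U> \<and> family_dim M \<W> \<le> ereal (of_int n)"
proof -
  interpret Metric_space M d by fact
  interpret isometric_group_action G M d \<phi>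
    using assms(3) unfolding isometric_action_def
    by (intro isometric_group_action.intro isometric_group_action_axioms.intro \<open>Metric_space M d\<close>) auto
  show ?thesis
    using assms(4,5,7) open_F_refinement by (simp add: covering_dim_eq_iff)
qed

end
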